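(* Let $k\ge 3$ be an integer. Then $W_c(k,2)>k(k-1)$.
   Context: For positive integers $k,N,d$ with $k\ge 3$, a $k$-term cyclic arithmetic progression mod $N$ with common difference $d$ is a $k$-element subset of $\mathbb{Z}_N=\mathbb{Z}/N\mathbb{Z}$ of the form $\{t,t+d,\ldots,t+(k-1)d\}$ for some $t\in\mathbb{Z}_N$ (so these $k$ elements are pairwise distinct mod $N$). An $r$-coloring of a set $S$ is a map $c:S\to\{1,\ldots,r\}$; a subset of $S$ is monochromatic if $c$ is constant on it. For integers $k\ge 3$, $r\ge 2$, the cyclic Van der Waerden number $W_c(k,r)$ is the smallest modulus $N$ such that for all positive integers $M\ge N$ and every $r$-coloring of $\mathbb{Z}_M$, there exists a monochromatic $k$-term cyclic arithmetic progression mod $M$ in $\mathbb{Z}_M$. (This number always exists.) *)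

theory Defs
  imports Main "HOL-Library.FuncSet"
begin

text \<open>\<open>\<int>\<^sub>N\<close> is represented by the canonical residues \<open>{..<N}\<close>, with addition modulo \<open>N\<close>.\<close>

definition cyclic_AP :: "nat \<Rightarrow> nat \<Rightarrow> nat \<Rightarrow> nat set \<Rightarrow> bool" where
  "cyclic_AP k N d A \<longleftrightarrow>
     card A = k \<and> (\<exists>t\<in>{..<N}. A = (\<lambda>i. (t + i * d) mod N) ` {..<k})"

definition monochromatic :: "(nat \<Rightarrow> nat) \<Rightarrow> nat set \<Rightarrow> bool" where
  "monochromatic c A \<longleftrightarrow> (\<forall>x\<in>A. \<forall>y\<in>A. c x = c y)"

definition W_c :: "nat \<Rightarrow> nat \<Rightarrow> nat" where
  "W_c k r = (LEAST N. N > 0 \<and>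
     (\<forall>M\<ge>N. \<forall>c \<in> {..<M} \<rightarrow> {1..r}. \<exists>d>0. \<exists>A. cyclic_AP k M d A \<and> monochromatic c A))"

end

theory Submission
  imports Defs "HOL-Library.Countable"
begin

text \<open>
  Van der Waerden's theorem, proved by colour focusing, guarantees that the minimum defining
  \<open>W_c\<close> is attained. For the lower bound put \<open>n = k - 1\<close> and colour \<open>\<int>\<^sub>M\<close>, \<open>M = 2n\<^sup>2\<close>, by
  alternating blocks of length \<open>n\<close>. A monochromatic sequence of \<open>n + 1\<close> terms projects to
  a progression modulo \<open>2n\<close> that never leaves a half circle, so its difference is a multiple
  of \<open>2n\<close>; but then the terms with indices \<open>0\<close> and \<open>n\<close> coincide modulo \<open>M\<close>.
  As \<open>M \<ge> k(k - 1)\<close>, this suffices.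
\<close>

section \<open>Van der Waerden's theorem\<close>

definition mono_AP :: "(nat \<Rightarrow> nat) \<Rightarrow> nat \<Rightarrow> nat \<Rightarrow> nat \<Rightarrow> nat \<Rightarrow> bool" where
  "mono_AP c l \<kappa> t d \<longleftrightarrow> d > 0 \<and> (\<forall>j<l. c (t + j * d) = \<kappa>)"

lemma mono_AP_Suc: "mono_AP c (Suc l) \<kappa> t d \<longleftrightarrow> mono_AP c l \<kappa> t d \<and> c (t + l * d) = \<kappa>"
  by (auto simp: mono_AP_def less_Suc_eq)

lemma mono_AP_shift: "mono_AP (\<lambda>x. c (a + x)) l \<kappa> t d \<longleftrightarrow> mono_AP c l \<kappa> (a + t) d"
  by (simp add: mono_AP_def add.assoc)

text \<open>The bound is on \<open>t + l * d\<close>, one step beyond the last term, so that the focus fits too.\<close>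

definition vdW :: "nat \<Rightarrow> bool" where
  "vdW l \<longleftrightarrow> (\<forall>C. finite C \<longrightarrow> (\<exists>N. \<forall>c. range c \<subseteq> C \<longrightarrow>
     (\<exists>\<kappa> t d. mono_AP c l \<kappa> t d \<and> t + l * d < N)))"

text \<open>The elements of \<open>K\<close> are the colours of the spokes focused at \<open>f\<close>.\<close>

definition focused :: "(nat \<Rightarrow> nat) \<Rightarrow> nat \<Rightarrow> nat \<Rightarrow> nat set \<Rightarrow> bool" where
  "focused c l f K \<longleftrightarrow> (\<forall>\<kappa>\<in>K. \<exists>t d. mono_AP c l \<kappa> t d \<and> t + l * d = f)"

text \<open>Each block of \<open>n\<close> consecutive integers counts as one letter, coloured by
  its whole word of colours. Only finitely many words over \<open>C\<close> occur, so
  \<open>vdW l\<close> applies to the sequence of blocks. \<open>to_nat\<close> turns words back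
  into colours.\<close>

lemma vdW_blocks:
  fixes C :: "nat set"
  assumes "vdW l" and "finite C"
  obtains N where "\<And>c. range c \<subseteq> C \<Longrightarrow>
    \<exists>T D. D > 0 \<and> T + l * D < N \<and> (\<forall>j<l. \<forall>x<n. c ((T + j * D) * n + x) = c (T * n + x))"
proof -
  let ?L = "{xs. set xs \<subseteq> C \<and> length xs = n}"
  have "finite (to_nat ` ?L)"
    using finite_lists_length_eq[OF assms(2)] by simp
  then obtain N where N: "\<And>c. range c \<subseteq> to_nat ` ?L \<Longrightarrow>
      \<exists>\<kappa> t d. mono_AP c l \<kappa> t d \<and> t + l * d < N"
    using assms(1) unfolding vdW_def by meson
  show thesis
  proof (rule that)
    fix c :: "nat \<Rightarrow> nat" assume c: "range c \<subseteq> C"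
    define b where "b i = map (\<lambda>x. c (i * n + x)) [0..<n]" for i
    have "range (\<lambda>i. to_nat (b i)) \<subseteq> to_nat ` ?L"
      using c by (fastforce simp: b_def intro!: imageI)
    from N[OF this] obtain \<kappa> T D
      where TD: "mono_AP (\<lambda>i. to_nat (b i)) l \<kappa> T D" "T + l * D < N" by blast
    have "c ((T + j * D) * n + x) = c (T * n + x)" if "j < l" "x < n" for j x
    proof -
      have "to_nat (b (T + j * D)) = \<kappa>" "to_nat (b (T + 0 * D)) = \<kappa>"
        using TD(1) that by (auto simp: mono_AP_def)
      then have "to_nat (b (T + j * D)) = to_nat (b T)" by simp
      then have "b (T + j * D) = b T" by (rule injD[OF inj_to_nat])
      then have "b (T + j * D) ! x = b T ! x" by simp
      then show ?thesis using that by (simp add: b_def)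
    qed
    then show "\<exists>T D. D > 0 \<and> T + l * D < N \<and>
        (\<forall>j<l. \<forall>x<n. c ((T + j * D) * n + x) = c (T * n + x))"
      using TD by (auto simp: mono_AP_def)
  qed
qed

text \<open>The copies of \<open>f\<close> in the \<open>l\<close> equal blocks form a new spoke of
  difference \<open>D * n\<close>. An old spoke, read diagonally with its \<open>j\<close>-th term
  taken from the \<open>j\<close>-th block, has difference \<open>D * n + d\<close>. All of them
  meet at the copy of \<open>f\<close> one block step further on.\<close>

lemma focus_step:
  assumes foc: "focused (\<lambda>x. c (T * n + x)) l f K" and "f < n" "D > 0"
    and blk: "\<And>j x. j < l \<Longrightarrow> x < n \<Longrightarrow> c ((T + j * D) * n + x) = c (T * n + x)"
  shows "focused c l ((T + l * D) * n + f) (insert (c (T * n + f)) K)"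
  unfolding focused_def
proof
  fix \<kappa> assume "\<kappa> \<in> insert (c (T * n + f)) K"
  then consider "\<kappa> = c (T * n + f)" | "\<kappa> \<in> K" by blast
  then show "\<exists>t d. mono_AP c l \<kappa> t d \<and> t + l * d = (T + l * D) * n + f"
  proof cases
    case 1
    have "c (T * n + f + j * (D * n)) = \<kappa>" if "j < l" for j
      using blk[OF that \<open>f < n\<close>] 1 by (simp add: algebra_simps)
    then have "mono_AP c l \<kappa> (T * n + f) (D * n)"
      using \<open>f < n\<close> \<open>D > 0\<close> by (simp add: mono_AP_def)
    then show ?thesis by (intro exI conjI) (auto simp: algebra_simps)
  next
    case 2
    then obtain t d where td: "mono_AP (\<lambda>x. c (T * n + x)) l \<kappa> t d" "t + l * d = f"
      using foc by (auto simp: focused_def)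
    have "c (T * n + t + j * (D * n + d)) = \<kappa>" if "j < l" for j
    proof -
      \<comment> \<open>Terms of a spoke precede its focus, so they stay inside the block and
        \<open>blk\<close> applies.\<close>
      have "j * d \<le> l * d" using that by simp
      then have "t + j * d < n" using td(2) \<open>f < n\<close> by linarith
      moreover have "c (T * n + (t + j * d)) = \<kappa>" using td(1) that by (simp add: mono_AP_def)
      ultimately show ?thesis using blk[OF that, of "t + j * d"] by (simp add: algebra_simps)
    qed
    then have "mono_AP c l \<kappa> (T * n + t) (D * n + d)"
      using td(1) by (simp add: mono_AP_def)
    moreover have "T * n + t + l * (D * n + d) = (T + l * D) * n + f"
      using td(2) by (simp add: algebra_simps)
    ultimately show ?thesis by blast
  qed
qed

text \<open>Induction on the number \<open>s\<close> of distinct spoke colours. If the focus has the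
  colour of some spoke, that spoke extends to \<open>Suc l\<close> terms; otherwise repeating the
  block adds the colour of the focus as a new one.\<close>

lemma colour_focusing:
  assumes "vdW l" and "finite C"
  shows "\<exists>n. \<forall>c. range c \<subseteq> C \<longrightarrow>
    (\<exists>\<kappa> t d. mono_AP c (Suc l) \<kappa> t d \<and> t + l * d < n) \<or>
    (\<exists>f<n. \<exists>K\<subseteq>C. card K = s \<and> focused c l f K)"
proof (induction s)
  case 0
  show ?case
    by (rule exI[of _ 1]) (auto simp: focused_def)
next
  case (Suc s)
  then obtain n where n: "\<And>c. range c \<subseteq> C \<Longrightarrow>
    (\<exists>\<kappa> t d. mono_AP c (Suc l) \<kappa> t d \<and> t + l * d < n) \<or>
    (\<exists>f<n. \<exists>K\<subseteq>C. card K = s \<and> focused c l f K)" by blast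
  obtain N where N: "\<And>c. range c \<subseteq> C \<Longrightarrow>
    \<exists>T D. D > 0 \<and> T + l * D < N \<and> (\<forall>j<l. \<forall>x<n. c ((T + j * D) * n + x) = c (T * n + x))"
    using vdW_blocks[OF assms] by blast
  show ?case
  proof (rule exI[of _ "N * n"], intro allI impI)
    fix c :: "nat \<Rightarrow> nat" assume c: "range c \<subseteq> C"
    obtain T D where TD: "D > 0" "T + l * D < N"
      and blk: "\<And>j x. j < l \<Longrightarrow> x < n \<Longrightarrow> c ((T + j * D) * n + x) = c (T * n + x)"
      using N[OF c] by blast
    have bound: "(T + i) * n + x < N * n" if "i \<le> l * D" "x < n" for i x
    proof -
      have "Suc (T + i) * n \<le> N * n" using TD(2) that(1) by (intro mult_right_mono) auto
      then show ?thesis using that(2) by simp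
    qed
    \<comment> \<open>The colouring seen from the start of block \<open>T\<close>: the induction
      hypothesis, with bound \<open>n\<close>, works inside this block.\<close>
    let ?c = "\<lambda>x. c (T * n + x)"
    have "range ?c \<subseteq> C" using c by auto
    from n[OF this] consider
        \<kappa> t d where "mono_AP ?c (Suc l) \<kappa> t d" "t + l * d < n"
      | f K where "f < n" "K \<subseteq> C" "card K = s" "focused ?c l f K" "?c f \<in> K"
      | f K where "f < n" "K \<subseteq> C" "card K = s" "focused ?c l f K" "?c f \<notin> K"
      by blast
    then show "(\<exists>\<kappa> t d. mono_AP c (Suc l) \<kappa> t d \<and> t + l * d < N * n) \<or>
      (\<exists>f<N * n. \<exists>K\<subseteq>C. card K = Suc s \<and> focused c l f K)"
    proof cases
      case 1
      then have "mono_AP c (Suc l) \<kappa> (T * n + t) d" by (simp add: mono_AP_shift)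
      moreover have "T * n + t + l * d < N * n" using bound[of 0 "t + l * d"] 1 by simp
      ultimately show ?thesis by blast
    next
      case 2
      then obtain t d where td: "mono_AP ?c l (?c f) t d" "t + l * d = f"
        unfolding focused_def by blast
      then have "mono_AP ?c (Suc l) (?c f) t d" by (simp add: mono_AP_Suc)
      then have "mono_AP c (Suc l) (?c f) (T * n + t) d" by (simp add: mono_AP_shift)
      moreover have "T * n + t + l * d < N * n" using bound[of 0 f] 2(1) td(2) by simp
      ultimately show ?thesis by blast
    next
      case 3
      have "focused c l ((T + l * D) * n + f) (insert (?c f) K)"
        using focus_step[OF 3(4,1) TD(1) blk] .
      moreover have "card (insert (?c f) K) = Suc s"
        using 3 finite_subset[OF _ assms(2)] by simp
      moreover have "insert (?c f) K \<subseteq> C" using c 3(2) by auto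
      ultimately show ?thesis using bound[of "l * D" f] 3(1) by blast
    qed
  qed
qed

text \<open>Spokes in \<open>card C + 1\<close> distinct colours cannot exist, so only the long
  progression remains.\<close>

lemma vdW_Suc:
  assumes "vdW l" "l > 0"
  shows "vdW (Suc l)"
  unfolding vdW_def
proof (intro allI impI)
  fix C :: "nat set" assume C: "finite C"
  obtain n where n: "\<And>c. range c \<subseteq> C \<Longrightarrow>
    (\<exists>\<kappa> t d. mono_AP c (Suc l) \<kappa> t d \<and> t + l * d < n) \<or>
    (\<exists>f<n. \<exists>K\<subseteq>C. card K = Suc (card C) \<and> focused c l f K)"
    using colour_focusing[OF assms(1) C, where s = "Suc (card C)"] by meson
  show "\<exists>N. \<forall>c. range c \<subseteq> C \<longrightarrow> (\<exists>\<kappa> t d. mono_AP c (Suc l) \<kappa> t d \<and> t + Suc l * d < N)"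
  \<comment> \<open>Here \<open>n\<close> bounds only the last term. The extra step that
    \<open>vdW\<close> demands is at most \<open>l * d < n\<close>, because
    \<open>l > 0\<close>.\<close>
  proof (rule exI[of _ "2 * n"], intro allI impI)
    fix c :: "nat \<Rightarrow> nat" assume c: "range c \<subseteq> C"
    have "card K \<noteq> Suc (card C)" if "K \<subseteq> C" for K
      using card_mono[OF C that] by simp
    with n[OF c] obtain \<kappa> t d where *: "mono_AP c (Suc l) \<kappa> t d" "t + l * d < n"
      by blast
    have "d \<le> l * d" using assms(2) by simp
    moreover have "Suc l * d = l * d + d" by simp
    ultimately have "t + Suc l * d < 2 * n" using *(2) by linarith
    with * show "\<exists>\<kappa> t d. mono_AP c (Suc l) \<kappa> t d \<and> t + Suc l * d < 2 * n" by blast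
  qed
qed

lemma van_der_Waerden: "l > 0 \<Longrightarrow> vdW l"
proof (induction l rule: nat_induct_non_zero)
  case 1
  have "mono_AP c 1 (c 0) 0 1 \<and> 0 + 1 * 1 < (2::nat)" for c by (simp add: mono_AP_def)
  then show ?case unfolding vdW_def by blast
qed (rule vdW_Suc)

section \<open>Transfer to cyclic progressions\<close>

lemma cyclic_AP_if_less:
  assumes "d > 0" and "t + k * d < M"
  shows "cyclic_AP k M d ((\<lambda>i. t + i * d) ` {..<k})"
proof -
  have "t + i * d < M" if "i < k" for i
    using mult_right_mono[of i k d] that assms(2) by linarith
  then have "(\<lambda>i. t + i * d) ` {..<k} = (\<lambda>i. (t + i * d) mod M) ` {..<k}"
    by (intro image_cong) auto
  moreover have "card ((\<lambda>i. t + i * d) ` {..<k}) = k"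
    using assms(1) by (subst card_image) (auto simp: inj_on_def)
  ultimately show ?thesis
    using assms(2) by (auto simp: cyclic_AP_def)
qed

text \<open>A \<open>LEAST\<close> says something only if a witness exists. Van der Waerden's
  theorem supplies one, since a progression below \<open>M\<close> does not wrap around.\<close>

lemma W_c_property:
  assumes "k > 0" and "M \<ge> W_c k r" and "c \<in> {..<M} \<rightarrow> {1..r}"
  obtains d A where "d > 0" "cyclic_AP k M d A" "monochromatic c A"
proof -
  let ?P = "\<lambda>N. N > 0 \<and>
     (\<forall>M\<ge>N. \<forall>c \<in> {..<M} \<rightarrow> {1..r}. \<exists>d>0. \<exists>A. cyclic_AP k M d A \<and> monochromatic c A)"
  obtain N where N: "\<And>c. range c \<subseteq> {0..r} \<Longrightarrow> \<exists>\<kappa> t d. mono_AP c k \<kappa> t d \<and> t + k * d < N"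
    using van_der_Waerden[OF assms(1)] unfolding vdW_def by (meson finite_atLeastAtMost)
  have "\<exists>d>0. \<exists>A. cyclic_AP k M d A \<and> monochromatic c A"
    if M: "M \<ge> Suc N" and c: "c \<in> {..<M} \<rightarrow> {1..r}" for M c
  proof -
    \<comment> \<open>\<open>c\<close> is constrained only below \<open>M\<close>, so it is extended
      by the extra colour 0; the progression found stays below \<open>M\<close> and never meets the
      extension.\<close>
    let ?c = "\<lambda>x. if x < M then c x else 0"
    have "range ?c \<subseteq> {0..r}" using c by (auto simp: Pi_def)
    from N[OF this] obtain \<kappa> t d where td: "mono_AP ?c k \<kappa> t d" "t + k * d < N" by blast
    have less: "t + i * d < M" if "i < k" for i
      using mult_right_mono[of i k d] that td(2) M by linarith
    have "c (t + i * d) = \<kappa>" if "i < k" for i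
    proof -
      have "?c (t + i * d) = \<kappa>" using td(1) that unfolding mono_AP_def by blast
      then show ?thesis using less[OF that] by simp
    qed
    then have "monochromatic c ((\<lambda>i. t + i * d) ` {..<k})"
      by (auto simp: monochromatic_def)
    moreover have "d > 0" using td(1) by (simp add: mono_AP_def)
    moreover have "t + k * d < M" using td(2) M by simp
    ultimately show ?thesis using cyclic_AP_if_less by blast
  qed
  then have "?P (Suc N)" by blast
  then have "?P (LEAST N. ?P N)" by (rule LeastI)
  then have "?P (W_c k r)" unfolding W_c_def .
  then show thesis using assms(2,3) that by blast
qed

section \<open>The block colouring\<close>

text \<open>A nonzero residue \<open>e\<close> of \<open>d\<close> moves each term forward by
  \<open>e\<close> if \<open>e \<le> n\<close>, and backward by \<open>2 * n - e\<close> otherwise.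
  Confined to \<open>n\<close> residues, the terms cannot jump across the other half, so they are
  strictly monotone; but \<open>n + 1\<close> terms do not fit.\<close>

lemma dvd_if_in_half_circle:
  fixes n t d :: nat
  assumes half: "\<And>i. i \<le> n \<Longrightarrow> (t + i * d) mod (2 * n) < n"
  shows "2 * n dvd d"
proof (rule ccontr)
  assume nd: "\<not> 2 * n dvd d"
  define g where "g i = (t + i * d) mod (2 * n)" for i
  define e where "e = d mod (2 * n)"
  have g: "g i < n" if "i \<le> n" for i using half[OF that] by (simp add: g_def)
  have "n > 0" using g[of 0] by (cases n) auto
  have e: "0 < e" "e < 2 * n"
    using nd \<open>n > 0\<close> by (auto simp: e_def dvd_eq_mod_eq_0)
  have step: "g (Suc i) = (g i + e) mod (2 * n)" for i
    by (simp add: g_def e_def mod_add_eq ac_simps)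
  show False
  proof (cases "e \<le> n")
    case True
    have "i \<le> g i" if "i \<le> n" for i
      using that
    proof (induction i)
      case (Suc i)
      then have "g (Suc i) = g i + e" using step[of i] g[of i] True by simp
      then show ?case using Suc e by simp
    qed simp
    from this[of n] g[of n] show False by simp
  next
    case False
    have "g i + i \<le> g 0" if "i \<le> n" for i
      using that
    proof (induction i)
      case (Suc i)
      then have i: "g i < n" "g (Suc i) < n" "g i + i \<le> g 0" using g by auto
      \<comment> \<open>Without a wraparound the next term would be at least \<open>e > n\<close>,
        outside the half circle.\<close>
      have "2 * n \<le> g i + e"
      proof (rule ccontr)
        assume "\<not> 2 * n \<le> g i + e"
        then have "g (Suc i) = g i + e" using step[of i] by simp
        then show False using i False by simp
      qed
      then have "g (Suc i) = g i + e - 2 * n"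
        using step[of i] i e by (simp add: le_mod_geq)
      then show ?case using i e \<open>2 * n \<le> g i + e\<close> by simp
    qed simp
    from this[of n] g[of 0] show False by simp
  qed
qed

text \<open>A translation by \<open>n\<close> exchanges the two halves.\<close>

lemma dvd_if_in_either_half_circle:
  fixes n t d :: nat
  assumes "n > 0" and same: "\<And>i. i \<le> n \<Longrightarrow> (t + i * d) mod (2 * n) < n \<longleftrightarrow> t mod (2 * n) < n"
  shows "2 * n dvd d"
proof (cases "t mod (2 * n) < n")
  case True
  then show ?thesis using same dvd_if_in_half_circle by blast
next
  case False
  have "(t + n + i * d) mod (2 * n) < n" if "i \<le> n" for i
  proof -
    define y where "y = (t + i * d) mod (2 * n)"
    have y: "n \<le> y" "y < 2 * n"
      using same[OF that] False \<open>n > 0\<close> by (auto simp: y_def)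
    have "(t + n + i * d) mod (2 * n) = (y + n) mod (2 * n)"
      unfolding y_def mod_add_left_eq by (simp add: ac_simps)
    also have "\<dots> = y - n" using y by (simp add: le_mod_geq)
    finally show ?thesis using y by linarith
  qed
  then show ?thesis by (rule dvd_if_in_half_circle)
qed

definition block_colouring :: "nat \<Rightarrow> nat \<Rightarrow> nat" where
  "block_colouring n x = (if x mod (2 * n) < n then 1 else 2)"

lemma no_monochromatic_cyclic_AP:
  assumes "n > 0" and AP: "cyclic_AP (Suc n) (2 * n * n) d A"
  shows "\<not> monochromatic (block_colouring n) A"
proof
  let ?M = "2 * n * n" and ?c = "block_colouring n"
  assume mono: "monochromatic ?c A"
  obtain t where A: "card A = Suc n" "A = (\<lambda>i. (t + i * d) mod ?M) ` {..<Suc n}"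
    using AP by (auto simp: cyclic_AP_def)
  \<comment> \<open>The \<open>n + 1\<close> indices yield a set of \<open>n + 1\<close> elements,
    so no two terms coincide.\<close>
  have "inj_on (\<lambda>i. (t + i * d) mod ?M) {..<Suc n}"
    using A by (intro eq_card_imp_inj_on) auto
  then have neq: "(t + n * d) mod ?M \<noteq> (t + 0 * d) mod ?M"
    using \<open>n > 0\<close> unfolding inj_on_def by blast
  \<comment> \<open>Reduction modulo \<open>?M\<close> preserves colours because
    \<open>2 * n\<close> divides \<open>?M\<close>.\<close>
  have c: "?c (x mod ?M) = ?c x" for x
    by (simp add: block_colouring_def mod_mod_cancel)
  have "?c (t + i * d) = ?c t" if "i \<le> n" for i
  proof -
    have "(t + j * d) mod ?M \<in> A" if "j \<le> n" for j
      using that unfolding A(2) by simp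
    from this[OF that] this[of 0] have "(t + i * d) mod ?M \<in> A" "(t + 0 * d) mod ?M \<in> A"
      by simp_all
    then have "?c ((t + i * d) mod ?M) = ?c ((t + 0 * d) mod ?M)"
      using mono unfolding monochromatic_def by blast
    then show ?thesis by (simp add: c)
  qed
  then have "(t + i * d) mod (2 * n) < n \<longleftrightarrow> t mod (2 * n) < n" if "i \<le> n" for i
    using that by (fastforce simp: block_colouring_def split: if_splits)
  then have "2 * n dvd d"
    using \<open>n > 0\<close> dvd_if_in_either_half_circle by blast
  then have "?M dvd n * d" by (simp add: mult.commute)
  then have "(t + n * d) mod ?M = t mod ?M" by (metis add_0_right dvd_imp_mod_0 mod_add_right_eq)
  with neq show False by simp
qed

theorem proposition4p6:
  fixes k :: nat
  assumes "k \<ge> 3"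
  shows "W_c k 2 > k * (k - 1)"
proof (rule ccontr)
  define n where "n = k - 1"
  have n: "n > 0" "k = Suc n" using assms by (auto simp: n_def)
  assume "\<not> W_c k 2 > k * (k - 1)"
  then have "W_c k 2 \<le> k * (k - 1)" by simp
  \<comment> \<open>\<open>W_c\<close> controls every modulus above it, so a bad colouring at the
    larger modulus \<open>2 * n * n\<close> is enough.\<close>
  also have "k * (k - 1) \<le> 2 * n * n" using n by simp
  finally have "W_c k 2 \<le> 2 * n * n" .
  moreover have "block_colouring n \<in> {..<2 * n * n} \<rightarrow> {1..2}"
    by (auto simp: block_colouring_def)
  moreover have "k > 0" using n by simp
  ultimately obtain d A where "cyclic_AP k (2 * n * n) d A" "monochromatic (block_colouring n) A"
    using W_c_property by blast
  then show False using no_monochromatic_cyclic_AP n by blast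
qed

end
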